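(* Let $\Bbbk$ be a field (of any characteristic), let $n>1$, and let $R=\Bbbk\langle x_1,\dots,x_n\rangle$ be the free associative unital $\Bbbk$-algebra. Let $\Delta(R)$ be the associative subalgebra of $D_{\Bbbk}(R)$ generated by $D^1_{\Bbbk}(R)$. Then $\partial_{(1,2)}^{(1,1)}\notin\Delta(R)$; hence $\Delta(R)\ne D_{\Bbbk}(R)$.
   Context: Differential operators (Lunts–Rosenberg): $\mathrm{Hom}_{\Bbbk}(R,R)$ is an $R$-bimodule via $(r\varphi)(s)=r\varphi(s)$ and $(\varphi r)(s)=\varphi(rs)$. For $r\in R$ put $[\varphi,r]=\varphi r-r\varphi$. Set $D^{-1}_{\Bbbk}(R)=0$ and, for $m\ge 0$, let $D^m_{\Bbbk}(R)$ be the $R$-subbimodule of $\mathrm{Hom}_{\Bbbk}(R,R)$ generated by all $\varphi$ such that $[\varphi,r]\in D^{m-1}_{\Bbbk}(R)$ for every $r\in R$. Then $D_{\Bbbk}(R)=\bigcup_{m\ge 0}D^m_{\Bbbk}(R)$, an algebra under composition. For $i\le n$, $a\in R$, $\partial_i^a$ is the $\Bbbk$-linear derivation of $R$ with $\partial_i^a(x_j)=\delta_{i,j}a$. The operator $\partial_{(1,2)}^{(1,1)}\in D^2_{\Bbbk}(R)$ is the unique $\Bbbk$-linear operator on $R$ with $[\partial_{(1,2)}^{(1,1)},x_1]=\partial_2^1$, $[\partial_{(1,2)}^{(1,1)},x_l]=0$ for $l\neq 1$, and $\partial_{(1,2)}^{(1,1)}(1)=0$. *)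

theory Defs
  imports Complex_Main "HOL-Library.Poly_Mapping" "HOL.Hull"
begin

section \<open>The free associative algebra\<close>

text \<open>The free monoid on \<open>'n\<close>. Lists are wrapped in order to keep a global \<open>plus\<close> instance
  for lists out of the way.\<close>

datatype 'n fmon = Mon "'n list"

instantiation fmon :: (type) monoid_add
begin

definition zero_fmon :: "'a fmon"
  where "0 = Mon []"

fun plus_fmon :: "'a fmon \<Rightarrow> 'a fmon \<Rightarrow> 'a fmon"
  where "Mon u + Mon v = Mon (u @ v)"

instance
proof
  fix a b c :: "'a fmon"
  show "a + b + c = a + (b + c)" by (cases a; cases b; cases c) simp
  show "0 + a = a" by (cases a) (simp add: zero_fmon_def)
  show "a + 0 = a" by (cases a) (simp add: zero_fmon_def)
qed

end

text \<open>The monoid algebra of the free monoid; its product is the convolution product of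
  finitely supported functions.\<close>

type_synonym ('n, 'k) falg = "'n fmon \<Rightarrow>\<^sub>0 'k"

definition gen :: "'n \<Rightarrow> ('n, 'k::field) falg"
  where "gen i = Poly_Mapping.single (Mon [i]) 1"

definition smul :: "'k::field \<Rightarrow> ('n, 'k) falg \<Rightarrow> ('n, 'k) falg"
  where "smul c p = Poly_Mapping.single 0 c * p"

lemma lookup_smul [simp]: "Poly_Mapping.lookup (smul c p) w = c * Poly_Mapping.lookup p w"
proof -
  have "Poly_Mapping.single 0 c * p = Poly_Mapping.map ((*) c) p"
    by (simp add: mult_map_scale_conv_mult)
  then show ?thesis
    by (simp add: smul_def map.rep_eq when_def)
qed

interpretation falg: vector_space "smul :: 'k::field \<Rightarrow> ('n, 'k) falg \<Rightarrow> ('n, 'k) falg"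
  by unfold_locales (auto intro!: poly_mapping_eqI simp: lookup_add algebra_simps)

lemma smul_mult_left: "smul c p * q = smul c (p * q)"
  by (simp add: smul_def mult.assoc)

lemma falg_expand:
  "p = (\<Sum>w\<in>Poly_Mapping.keys p. smul (Poly_Mapping.lookup p w) (Poly_Mapping.single w 1))"
  by (rule poly_mapping_eqI)
    (simp add: lookup_sum lookup_single when_def if_distrib[where f = "\<lambda>x. _ * x"]
      in_keys_iff cong: if_cong)

lemma mult_smul_right: "p * smul c q = smul c (p * q)"
proof -
  let ?m = "\<lambda>w. Poly_Mapping.single w 1"
  have w: "smul a (?m w) = Poly_Mapping.single w a" for a w
    by (simp add: smul_def mult_single)
  have "p * Poly_Mapping.single 0 c = Poly_Mapping.single 0 c * p"
    by (subst (1 2) falg_expand[of p])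
      (simp add: w sum_distrib_left sum_distrib_right mult_single mult.commute)
  then show ?thesis by (metis smul_def mult.assoc)
qed


section \<open>Differential operators\<close>

definition lin_ops :: "(('n, 'k::field) falg \<Rightarrow> ('n, 'k) falg) set"
  where "lin_ops = {\<phi>. Vector_Spaces.linear smul smul \<phi>}"

definition lact :: "('n, 'k::field) falg \<Rightarrow> (('n, 'k) falg \<Rightarrow> ('n, 'k) falg)
    \<Rightarrow> ('n, 'k) falg \<Rightarrow> ('n, 'k) falg"
  where "lact r \<phi> = (\<lambda>s. r * \<phi> s)"

definition ract :: "(('n, 'k::field) falg \<Rightarrow> ('n, 'k) falg) \<Rightarrow> ('n, 'k) falg
    \<Rightarrow> ('n, 'k) falg \<Rightarrow> ('n, 'k) falg"
  where "ract \<phi> r = (\<lambda>s. \<phi> (r * s))"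

definition comm :: "(('n, 'k::field) falg \<Rightarrow> ('n, 'k) falg) \<Rightarrow> ('n, 'k) falg
    \<Rightarrow> ('n, 'k) falg \<Rightarrow> ('n, 'k) falg"
  where "comm \<phi> r = (\<lambda>s. ract \<phi> r s - lact r \<phi> s)"

text \<open>Closure under negation and under scalars follows from the left action of
  \<open>smul c 1\<close>.\<close>

definition subbimodule :: "(('n, 'k::field) falg \<Rightarrow> ('n, 'k) falg) set \<Rightarrow> bool"
  where "subbimodule M \<longleftrightarrow> M \<subseteq> lin_ops \<and> (\<lambda>s. 0) \<in> M
    \<and> (\<forall>\<phi>\<in>M. \<forall>\<psi>\<in>M. (\<lambda>s. \<phi> s + \<psi> s) \<in> M)
    \<and> (\<forall>r. \<forall>\<phi>\<in>M. lact r \<phi> \<in> M \<and> ract \<phi> r \<in> M)"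

text \<open>The index is shifted by one: \<open>diff_lt m\<close> is $D^{m-1}$.\<close>

primrec diff_lt :: "nat \<Rightarrow> (('n, 'k::field) falg \<Rightarrow> ('n, 'k) falg) set"
  where
    "diff_lt 0 = {\<lambda>s. 0}"
  | "diff_lt (Suc m) = subbimodule hull {\<phi> \<in> lin_ops. \<forall>r. comm \<phi> r \<in> diff_lt m}"

definition diff_le :: "nat \<Rightarrow> (('n, 'k::field) falg \<Rightarrow> ('n, 'k) falg) set"
  where "diff_le m = diff_lt (Suc m)"

definition diff_ops :: "(('n, 'k::field) falg \<Rightarrow> ('n, 'k) falg) set"
  where "diff_ops = (\<Union>m. diff_le m)"

definition subalgebra :: "(('n, 'k::field) falg \<Rightarrow> ('n, 'k) falg) set \<Rightarrow> bool"
  where "subalgebra A \<longleftrightarrow> A \<subseteq> lin_ops \<and> id \<in> A \<and> (\<lambda>s. 0) \<in> A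
    \<and> (\<forall>\<phi>\<in>A. \<forall>\<psi>\<in>A. (\<lambda>s. \<phi> s + \<psi> s) \<in> A)
    \<and> (\<forall>c. \<forall>\<phi>\<in>A. (\<lambda>s. smul c (\<phi> s)) \<in> A)
    \<and> (\<forall>\<phi>\<in>A. \<forall>\<psi>\<in>A. \<phi> \<circ> \<psi> \<in> A)"

text \<open>\<open>subalgebra\<close> refers to subalgebras of all linear operators. The subalgebra generated
  inside \<open>diff_ops\<close> is the same, since \<open>diff_ops\<close> is itself a subalgebra
  (\<open>subalgebra_diff_ops\<close> below).\<close>

definition Delta :: "(('n, 'k::field) falg \<Rightarrow> ('n, 'k) falg) set"
  where "Delta = subalgebra hull (diff_le 1)"

section \<open>Derivations and the second order operators\<close>

definition derivation :: "(('n, 'k::field) falg \<Rightarrow> ('n, 'k) falg) \<Rightarrow> bool"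
  where "derivation d \<longleftrightarrow> d \<in> lin_ops \<and> (\<forall>r s. d (r * s) = d r * s + r * d s)"

definition partial :: "'n \<Rightarrow> ('n, 'k::field) falg \<Rightarrow> ('n, 'k) falg \<Rightarrow> ('n, 'k) falg"
  where "partial i a = (THE d. derivation d \<and> (\<forall>j. d (gen j) = (if i = j then a else 0)))"

text \<open>$\partial_{(i,j)}^{(1,1)}$\<close>

definition partial2 :: "'n \<Rightarrow> 'n \<Rightarrow> ('n, 'k::field) falg \<Rightarrow> ('n, 'k) falg"
  where "partial2 i j = (THE \<phi>. \<phi> \<in> lin_ops \<and> comm \<phi> (gen i) = partial j 1
    \<and> (\<forall>l. l \<noteq> i \<longrightarrow> comm \<phi> (gen l) = (\<lambda>s. 0)) \<and> \<phi> 1 = 0)"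

section \<open>Well-definedness\<close>

lemma lin_ops_iff: "\<phi> \<in> lin_ops \<longleftrightarrow>
    (\<forall>s t. \<phi> (s + t) = \<phi> s + \<phi> t) \<and> (\<forall>c s. \<phi> (smul c s) = smul c (\<phi> s))"
  unfolding lin_ops_def Vector_Spaces.linear_iff by (simp add: falg.vector_space_axioms)

lemma lin_ops_zero: "\<phi> \<in> lin_ops \<Longrightarrow> \<phi> 0 = 0"
  unfolding lin_ops_iff by (metis add_cancel_right_right)

lemma lin_ops_diff:
  assumes "\<phi> \<in> lin_ops"
  shows "\<phi> (s - t) = \<phi> s - \<phi> t"
proof -
  have "\<phi> (s - t + t) = \<phi> (s - t) + \<phi> t"
    using assms unfolding lin_ops_iff by blast
  then show ?thesis by simp
qed

lemma subbimodule_lin_ops: "subbimodule lin_ops"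
  unfolding subbimodule_def
  by (auto simp: lin_ops_iff lact_def ract_def algebra_simps mult_smul_right
      falg.scale_right_distrib)

lemma subbimoduleI:
  assumes "M \<subseteq> lin_ops" "(\<lambda>s. 0) \<in> M"
    and "\<And>\<phi> \<psi>. \<phi> \<in> M \<Longrightarrow> \<psi> \<in> M \<Longrightarrow> (\<lambda>s. \<phi> s + \<psi> s) \<in> M"
    and "\<And>r \<phi>. \<phi> \<in> M \<Longrightarrow> lact r \<phi> \<in> M"
    and "\<And>r \<phi>. \<phi> \<in> M \<Longrightarrow> ract \<phi> r \<in> M"
  shows "subbimodule M"
  using assms unfolding subbimodule_def by blast

lemma subbimoduleD:
  assumes "subbimodule M"
  shows "M \<subseteq> lin_ops" "(\<lambda>s. 0) \<in> M"
    and "\<phi> \<in> M \<Longrightarrow> \<psi> \<in> M \<Longrightarrow> (\<lambda>s. \<phi> s + \<psi> s) \<in> M"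
    and "\<phi> \<in> M \<Longrightarrow> lact r \<phi> \<in> M"
    and "\<phi> \<in> M \<Longrightarrow> ract \<phi> r \<in> M"
  using assms unfolding subbimodule_def by (blast, blast, metis, blast, blast)

lemma subbimodule_Inter:
  assumes T: "\<And>t. t \<in> T \<Longrightarrow> subbimodule t" "lin_ops \<in> T"
  shows "subbimodule (\<Inter>T)"
proof (rule subbimoduleI)
  show "\<Inter>T \<subseteq> lin_ops" using T(2) by (rule Inter_lower)
  show "(\<lambda>s. 0) \<in> \<Inter>T" using subbimoduleD(2)[OF T(1)] by (rule InterI)
next
  fix \<phi> \<psi> assume "\<phi> \<in> \<Inter>T" "\<psi> \<in> \<Inter>T"
  then show "(\<lambda>s. \<phi> s + \<psi> s) \<in> \<Inter>T"
    by (intro InterI subbimoduleD(3)[OF T(1)]) (simp_all only: Inter_iff)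
next
  fix r \<phi> assume "\<phi> \<in> \<Inter>T"
  then show "lact r \<phi> \<in> \<Inter>T" and "ract \<phi> r \<in> \<Inter>T"
    by (intro InterI subbimoduleD(4,5)[OF T(1)]; simp only: Inter_iff)+
qed

lemma subbimodule_diff_lt: "subbimodule (diff_lt m)"
proof (cases m)
  case 0
  show ?thesis
    unfolding 0 diff_lt.simps
    using subbimoduleD(2)[OF subbimodule_lin_ops]
    by (intro subbimoduleI) (auto simp: lact_def ract_def)
next
  case (Suc m')
  show ?thesis
    unfolding Suc diff_lt.simps hull_def
    by (rule subbimodule_Inter) (auto simp: subbimodule_lin_ops)
qed

lemma diff_lt_gen:
  "\<phi> \<in> lin_ops \<Longrightarrow> (\<And>r. comm \<phi> r \<in> diff_lt m) \<Longrightarrow> \<phi> \<in> diff_lt (Suc m)"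
  by (simp add: hull_inc)

lemma diff_lt_subset_lin_ops: "\<phi> \<in> diff_lt m \<Longrightarrow> \<phi> \<in> lin_ops"
  using subbimoduleD(1)[OF subbimodule_diff_lt] by (rule subsetD)

lemma diff_lt_Suc: "(diff_lt m :: (('n, 'k::field) falg \<Rightarrow> ('n, 'k) falg) set) \<subseteq> diff_lt (Suc m)"
proof (induction m)
  case 0
  show ?case
    using subbimoduleD(2)[OF subbimodule_diff_lt[of "Suc 0"]] by (simp del: diff_lt.simps(2))
next
  case (Suc m)
  have "({\<phi> \<in> lin_ops. \<forall>r. comm \<phi> r \<in> diff_lt m} :: (('n, 'k) falg \<Rightarrow> ('n, 'k) falg) set)
      \<subseteq> {\<phi> \<in> lin_ops. \<forall>r. comm \<phi> r \<in> diff_lt (Suc m)}"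
    using Suc by blast
  then show ?case
    unfolding diff_lt.simps(2)[of m] diff_lt.simps(2)[of "Suc m"] by (rule hull_mono)
qed

lemma diff_lt_mono: "m \<le> m' \<Longrightarrow> diff_lt m \<subseteq> diff_lt m'"
  using diff_lt_Suc by (rule lift_Suc_mono_le)

lemma diff_lt_comp:
  fixes \<phi> \<psi> :: "('n, 'k::field) falg \<Rightarrow> ('n, 'k) falg"
  shows "\<phi> \<in> diff_lt p \<Longrightarrow> \<psi> \<in> diff_lt q \<Longrightarrow> \<phi> \<circ> \<psi> \<in> diff_lt (p + q)"
proof (induction "p + q" arbitrary: p q \<phi> \<psi> rule: less_induct)
  case less
  let ?B = "diff_lt (p + q) :: (('n, 'k) falg \<Rightarrow> ('n, 'k) falg) set"
  have B: "subbimodule ?B" by (rule subbimodule_diff_lt)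
  have L: "subbimodule (lin_ops :: (('n, 'k) falg \<Rightarrow> ('n, 'k) falg) set)"
    by (rule subbimodule_lin_ops)
  have Q: "subbimodule (diff_lt q :: (('n, 'k) falg \<Rightarrow> ('n, 'k) falg) set)"
    by (rule subbimodule_diff_lt)
  note B = subbimoduleD[OF B] and L = subbimoduleD[OF L] and Q = subbimoduleD[OF Q]
  show ?case
  proof (cases "p = 0 \<or> q = 0")
    case True
    then have "\<phi> \<circ> \<psi> = (\<lambda>s. 0)"
      using less.prems lin_ops_zero[OF diff_lt_subset_lin_ops[OF less.prems(1)]] by auto
    then show ?thesis using B(2) by (simp only:)
  next
    case False
    then obtain p' q' where pq: "p = Suc p'" "q = Suc q'" by (metis not0_implies_Suc)
    let ?Gp = "{\<phi> \<in> lin_ops. \<forall>r. comm \<phi> r \<in> diff_lt p'} :: (('n, 'k) falg \<Rightarrow> ('n, 'k) falg) set"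
    let ?Gq = "{\<phi> \<in> lin_ops. \<forall>r. comm \<phi> r \<in> diff_lt q'} :: (('n, 'k) falg \<Rightarrow> ('n, 'k) falg) set"
    have gp: "?Gp \<subseteq> diff_lt p" and gq: "?Gq \<subseteq> diff_lt q"
      unfolding pq diff_lt.simps by (rule hull_subset)+
    have gens: "\<phi> \<circ> \<psi> \<in> ?B" if \<phi>: "\<phi> \<in> ?Gp" and \<psi>: "\<psi> \<in> ?Gq" for \<phi> \<psi>
    proof -
      have "comm (\<phi> \<circ> \<psi>) r \<in> diff_lt (p' + q)" for r
      proof -
        have "\<phi> (\<psi> (r * s) - r * \<psi> s) = \<phi> (\<psi> (r * s)) - \<phi> (r * \<psi> s)" for s
          using \<phi> by (intro lin_ops_diff) simp
        then have "comm (\<phi> \<circ> \<psi>) r = (\<lambda>s. (\<phi> \<circ> comm \<psi> r) s + (comm \<phi> r \<circ> \<psi>) s)"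
          by (auto simp: comm_def lact_def ract_def fun_eq_iff)
        moreover have "\<phi> \<circ> comm \<psi> r \<in> diff_lt (p + q')"
          using less.hyps[of p q' \<phi> "comm \<psi> r"] \<phi> \<psi> gp pq by auto
        moreover have "comm \<phi> r \<circ> \<psi> \<in> diff_lt (p' + q)"
          using less.hyps[of p' q "comm \<phi> r" \<psi>] \<phi> \<psi> gq pq by auto
        ultimately show ?thesis
          using subbimoduleD(3)[OF subbimodule_diff_lt[of "p' + q"],
              of "\<phi> \<circ> comm \<psi> r" "comm \<phi> r \<circ> \<psi>"]
          by (simp only: pq add_Suc add_Suc_right)
      qed
      moreover have "\<phi> \<circ> \<psi> \<in> lin_ops" using \<phi> \<psi> by (simp add: lin_ops_iff)
      ultimately have "\<phi> \<circ> \<psi> \<in> diff_lt (Suc (p' + q))" by (rule diff_lt_gen[rotated])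
      then show ?thesis by (simp only: pq add_Suc)
    qed
    have right: "\<phi> \<circ> \<psi> \<in> ?B" if \<phi>: "\<phi> \<in> ?Gp" and \<psi>: "\<psi> \<in> diff_lt q" for \<phi> \<psi>
    proof -
      have lin: "\<phi> \<in> lin_ops" using \<phi> by simp
      have "subbimodule {\<psi> \<in> diff_lt q. \<phi> \<circ> \<psi> \<in> ?B}" (is "subbimodule ?M")
      proof (rule subbimoduleI)
        show "?M \<subseteq> lin_ops" using diff_lt_subset_lin_ops by blast
        show "(\<lambda>s. 0) \<in> ?M"
          using B(2) Q(2) lin_ops_zero[OF lin]
          by (simp add: o_def)
      next
        fix \<psi>1 \<psi>2 assume a: "\<psi>1 \<in> ?M" "\<psi>2 \<in> ?M"
        have "\<phi> \<circ> (\<lambda>s. \<psi>1 s + \<psi>2 s) = (\<lambda>s. (\<phi> \<circ> \<psi>1) s + (\<phi> \<circ> \<psi>2) s)"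
          using lin by (auto simp: lin_ops_iff)
        then show "(\<lambda>s. \<psi>1 s + \<psi>2 s) \<in> ?M"
          using a B(3)[of "\<phi> \<circ> \<psi>1" "\<phi> \<circ> \<psi>2"]
            Q(3)[of \<psi>1 \<psi>2] by simp
      next
        fix r \<psi> assume a: "\<psi> \<in> ?M"
        have "comm \<phi> r \<circ> \<psi> \<in> diff_lt (p' + q)"
          using less.hyps[of p' q "comm \<phi> r" \<psi>] \<phi> a pq by auto
        then have 1: "comm \<phi> r \<circ> \<psi> \<in> ?B"
          using diff_lt_mono[of "p' + q" "p + q"] pq by auto
        have "\<phi> \<circ> lact r \<psi> = (\<lambda>s. lact r (\<phi> \<circ> \<psi>) s + (comm \<phi> r \<circ> \<psi>) s)"
          by (auto simp: comm_def lact_def ract_def)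
        then have "\<phi> \<circ> lact r \<psi> \<in> ?B"
          using 1 a B(3)[OF B(4), of "\<phi> \<circ> \<psi>" "comm \<phi> r \<circ> \<psi>" r] by simp
        then show "lact r \<psi> \<in> ?M"
          using a Q(4)[of \<psi> r] by simp
        have "\<phi> \<circ> ract \<psi> r = ract (\<phi> \<circ> \<psi>) r" by (auto simp: ract_def)
        then show "ract \<psi> r \<in> ?M"
          using a B(5)[of "\<phi> \<circ> \<psi>" r] Q(5)[of \<psi> r] by simp
      qed
      moreover have "?Gq \<subseteq> ?M" using gens[OF \<phi>] gq by blast
      ultimately have "subbimodule hull ?Gq \<subseteq> ?M" by (rule hull_minimal[where S = subbimodule, rotated])
      then show ?thesis using \<psi> unfolding pq diff_lt.simps by blast
    qed
    have "subbimodule {\<phi> :: ('n, 'k) falg \<Rightarrow> ('n, 'k) falg. \<phi> \<in> lin_ops \<and> (\<forall>\<psi>\<in>diff_lt q. \<phi> \<circ> \<psi> \<in> ?B)}"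
      (is "subbimodule ?M")
    proof (rule subbimoduleI)
      show "?M \<subseteq> lin_ops" by blast
      have "(\<lambda>s. 0) \<circ> \<psi> \<in> ?B" for \<psi> :: "('n, 'k) falg \<Rightarrow> ('n, 'k) falg"
        using B(2) by (simp only: o_def)
      then show "(\<lambda>s. 0) \<in> ?M" using L(2) by blast
    next
      fix \<phi>1 \<phi>2 assume a: "\<phi>1 \<in> ?M" "\<phi>2 \<in> ?M"
      have "(\<lambda>s. \<phi>1 s + \<phi>2 s) \<circ> \<psi> \<in> ?B" if "\<psi> \<in> diff_lt q" for \<psi>
        using B(3)[of "\<phi>1 \<circ> \<psi>" "\<phi>2 \<circ> \<psi>"] a that by (simp add: o_def)
      then show "(\<lambda>s. \<phi>1 s + \<phi>2 s) \<in> ?M"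
        using a L(3)[of \<phi>1 \<phi>2] by blast
    next
      fix r \<phi> assume a: "\<phi> \<in> ?M"
      have "lact r \<phi> \<circ> \<psi> \<in> ?B" if "\<psi> \<in> diff_lt q" for \<psi>
        using B(4)[of "\<phi> \<circ> \<psi>" r] a that by (simp add: lact_def o_def)
      then show "lact r \<phi> \<in> ?M" using a L(4)[of \<phi> r] by blast
      have "ract \<phi> r \<circ> \<psi> \<in> ?B" if "\<psi> \<in> diff_lt q" for \<psi>
      proof -
        have "ract \<phi> r \<circ> \<psi> = \<phi> \<circ> lact r \<psi>" by (auto simp: lact_def ract_def)
        then show ?thesis using a Q(4)[OF that, of r] by simp
      qed
      then show "ract \<phi> r \<in> ?M" using a L(5)[of \<phi> r] by blast
    qed
    moreover have "?Gp \<subseteq> ?M" using right by blast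
    ultimately have "subbimodule hull ?Gp \<subseteq> ?M" by (rule hull_minimal[where S = subbimodule, rotated])
    then show ?thesis using less.prems unfolding pq diff_lt.simps by blast
  qed
qed

lemma diff_ops_iff: "\<phi> \<in> diff_ops \<longleftrightarrow> (\<exists>m. \<phi> \<in> diff_lt m)"
  using diff_lt_Suc by (auto simp: diff_ops_def diff_le_def simp del: diff_lt.simps)

lemma subalgebra_diff_ops: "subalgebra (diff_ops :: (('n, 'k::field) falg \<Rightarrow> ('n, 'k) falg) set)"
  unfolding subalgebra_def
proof (intro conjI ballI allI)
  show "(diff_ops :: (('n, 'k) falg \<Rightarrow> ('n, 'k) falg) set) \<subseteq> lin_ops" using diff_lt_subset_lin_ops by (auto simp: diff_ops_iff)
  show "(\<lambda>s. 0) \<in> (diff_ops :: (('n, 'k) falg \<Rightarrow> ('n, 'k) falg) set)" by (auto simp: diff_ops_iff intro!: exI[of _ 0])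
  have "id \<in> (diff_lt (Suc 0) :: (('n, 'k) falg \<Rightarrow> ('n, 'k) falg) set)"
    by (rule diff_lt_gen) (auto simp: lin_ops_iff comm_def lact_def ract_def)
  then show "id \<in> (diff_ops :: (('n, 'k) falg \<Rightarrow> ('n, 'k) falg) set)" unfolding diff_ops_iff by blast
next
  fix \<phi> \<psi> :: "('n, 'k) falg \<Rightarrow> ('n, 'k) falg" assume "\<phi> \<in> diff_ops" "\<psi> \<in> diff_ops"
  then obtain p q where pq: "\<phi> \<in> diff_lt p" "\<psi> \<in> diff_lt q" by (auto simp: diff_ops_iff)
  then show "\<phi> \<circ> \<psi> \<in> diff_ops" unfolding diff_ops_iff by (intro exI[of _ "p + q"] diff_lt_comp)
  have "\<phi> \<in> diff_lt (p + q)" "\<psi> \<in> diff_lt (p + q)"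
    using pq diff_lt_mono[of p "p + q"] diff_lt_mono[of q "p + q"] by auto
  then show "(\<lambda>s. \<phi> s + \<psi> s) \<in> diff_ops"
    using subbimoduleD(3)[OF subbimodule_diff_lt] unfolding diff_ops_iff by blast
next
  fix c and \<phi> :: "('n, 'k) falg \<Rightarrow> ('n, 'k) falg" assume "\<phi> \<in> diff_ops"
  then obtain m where "\<phi> \<in> diff_lt m" by (auto simp: diff_ops_iff)
  then have "lact (smul c 1) \<phi> \<in> diff_lt m"
    by (rule subbimoduleD(4)[OF subbimodule_diff_lt])
  then show "(\<lambda>s. smul c (\<phi> s)) \<in> diff_ops"
    by (auto simp: diff_ops_iff lact_def smul_mult_left)
qed

lemma Delta_subset_diff_ops:
  "(Delta :: (('n, 'k::field) falg \<Rightarrow> ('n, 'k) falg) set) \<subseteq> diff_ops"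
proof -
  have "diff_le 1 \<subseteq> (diff_ops :: (('n, 'k) falg \<Rightarrow> ('n, 'k) falg) set)"
    by (auto simp: diff_ops_def)
  then show ?thesis
    unfolding Delta_def using subalgebra_diff_ops by (rule hull_minimal)
qed

text \<open>A linear operator is determined by its value at 1 and its commutators with the
  generators, and these can be prescribed.\<close>

primrec op_on_word :: "('n \<Rightarrow> ('n, 'k::field) falg \<Rightarrow> ('n, 'k) falg) \<Rightarrow> ('n, 'k) falg
    \<Rightarrow> 'n list \<Rightarrow> ('n, 'k) falg"
  where
    "op_on_word f c [] = c"
  | "op_on_word f c (i # w) = gen i * op_on_word f c w + f i (Poly_Mapping.single (Mon w) 1)"

lemma single_Cons: "Poly_Mapping.single (Mon (i # w)) 1 = gen i * Poly_Mapping.single (Mon w) 1"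
  by (simp add: gen_def mult_single)

lemma single_Nil: "Poly_Mapping.single (Mon []) 1 = 1"
  by (simp flip: zero_fmon_def)

lemma lin_ops_sum: "\<phi> \<in> lin_ops \<Longrightarrow> \<phi> (sum f A) = (\<Sum>a\<in>A. \<phi> (f a))"
  by (induction A rule: infinite_finite_induct) (auto simp: lin_ops_zero lin_ops_iff)

lemma lin_ops_eqI:
  assumes "\<phi> \<in> lin_ops" "\<psi> \<in> lin_ops"
    and "\<And>w. \<phi> (Poly_Mapping.single (Mon w) 1) = \<psi> (Poly_Mapping.single (Mon w) 1)"
  shows "\<phi> = \<psi>"
proof
  fix p
  have eq: "\<phi> (Poly_Mapping.single w 1) = \<psi> (Poly_Mapping.single w 1)" for w
    using assms(3) by (cases w) simp
  show "\<phi> p = \<psi> p"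
    using assms(1,2)
    by (subst (1 2) falg_expand[of p], simp add: lin_ops_sum) (simp add: lin_ops_iff eq)
qed

lemma lin_ops_extend:
  fixes g :: "'n list \<Rightarrow> ('n, 'k::field) falg"
  shows "\<exists>\<phi>\<in>lin_ops. \<forall>w. \<phi> (Poly_Mapping.single (Mon w) 1) = g w"
proof -
  let ?h = "\<lambda>(p :: ('n, 'k) falg) w. smul (Poly_Mapping.lookup p w) (case w of Mon u \<Rightarrow> g u)"
  define \<phi> where "\<phi> p = sum (?h p) (Poly_Mapping.keys p)" for p
  have sup: "\<phi> p = sum (?h p) S" if "finite S" "Poly_Mapping.keys p \<subseteq> S" for p S
    unfolding \<phi>_def using that by (intro sum.mono_neutral_left) (auto simp: in_keys_iff)
  have "\<phi> (p + q) = \<phi> p + \<phi> q" for p q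
  proof -
    let ?S = "Poly_Mapping.keys p \<union> Poly_Mapping.keys q"
    have "\<phi> (p + q) = sum (?h (p + q)) ?S" by (rule sup) (auto simp: Poly_Mapping.keys_add)
    moreover have "\<phi> p = sum (?h p) ?S" "\<phi> q = sum (?h q) ?S" by (rule sup; simp)+
    ultimately show ?thesis
      by (simp add: lookup_add falg.scale_left_distrib sum.distrib)
  qed
  moreover have "\<phi> (smul c p) = smul c (\<phi> p)" for c p
  proof -
    have "\<phi> (smul c p) = sum (?h (smul c p)) (Poly_Mapping.keys p)"
      by (rule sup) (auto simp: in_keys_iff)
    then show ?thesis by (simp add: \<phi>_def falg.scale_sum_right)
  qed
  moreover have "\<phi> (Poly_Mapping.single (Mon w) 1) = g w" for w
    by (subst sup[of "{Mon w}"]) auto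
  ultimately show ?thesis by (intro bexI[of _ \<phi>]) (simp_all add: lin_ops_iff)
qed

lemma ex1_comm:
  fixes f :: "'n \<Rightarrow> ('n, 'k::field) falg \<Rightarrow> ('n, 'k) falg"
  assumes f: "\<And>i. f i \<in> lin_ops"
  shows "\<exists>!\<phi>. \<phi> \<in> lin_ops \<and> (\<forall>i. comm \<phi> (gen i) = f i) \<and> \<phi> 1 = c"
proof -
  obtain \<phi> where \<phi>: "\<phi> \<in> lin_ops"
      and \<phi>w: "\<And>w. \<phi> (Poly_Mapping.single (Mon w) 1) = op_on_word f c w"
    using lin_ops_extend[of "op_on_word f c"] by blast
  have "comm \<phi> (gen i) = f i" for i
  proof (rule lin_ops_eqI)
    show "comm \<phi> (gen i) \<in> lin_ops"
      using \<phi> by (auto simp: lin_ops_iff comm_def lact_def ract_def algebra_simps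
          mult_smul_right falg.scale_right_diff_distrib)
    show "f i \<in> lin_ops" by (rule f)
    show "comm \<phi> (gen i) (Poly_Mapping.single (Mon w) 1) = f i (Poly_Mapping.single (Mon w) 1)" for w
      by (simp add: comm_def lact_def ract_def \<phi>w flip: single_Cons)
  qed
  moreover have "\<phi> 1 = c" using \<phi>w[of "[]"] by (simp add: single_Nil)
  moreover have "\<psi> = \<phi>" if \<psi>: "\<psi> \<in> lin_ops" "\<And>i. comm \<psi> (gen i) = f i" "\<psi> 1 = c" for \<psi>
  proof (rule lin_ops_eqI)
    fix w
    have "\<psi> (Poly_Mapping.single (Mon w) 1) = op_on_word f c w"
    proof (induction w)
      case Nil
      then show ?case using \<psi>(3) by (simp add: single_Nil)
    next
      case (Cons i w)
      have "\<psi> (gen i * s) = gen i * \<psi> s + f i s" for s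
        using fun_cong[OF \<psi>(2)[of i], of s]
        by (simp add: comm_def lact_def ract_def algebra_simps)
      then show ?case using Cons by (simp add: single_Cons)
    qed
    then show "\<psi> (Poly_Mapping.single (Mon w) 1) = \<phi> (Poly_Mapping.single (Mon w) 1)"
      by (simp add: \<phi>w)
  qed (use \<psi> \<phi> in auto)
  ultimately show ?thesis using \<phi> by blast
qed

lemma derivation_one: "derivation d \<Longrightarrow> d 1 = 0"
  unfolding derivation_def by (metis add_cancel_right_right mult_1_left mult_1_right)

lemma derivation_iff_comm:
  assumes d: "d \<in> lin_ops"
  shows "derivation d \<and> (\<forall>j. d (gen j) = a j) \<longleftrightarrow>
    (\<forall>j. comm d (gen j) = (\<lambda>s. a j * s)) \<and> d 1 = 0"
proof
  assume "derivation d \<and> (\<forall>j. d (gen j) = a j)"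
  then show "(\<forall>j. comm d (gen j) = (\<lambda>s. a j * s)) \<and> d 1 = 0"
    by (auto simp: derivation_one comm_def lact_def ract_def derivation_def)
next
  assume R: "(\<forall>j. comm d (gen j) = (\<lambda>s. a j * s)) \<and> d 1 = 0"
  have step: "d (gen j * s) = gen j * d s + a j * s" for j s
    using R[THEN conjunct1, rule_format, THEN fun_cong, of j s]
    by (simp add: comm_def lact_def ract_def algebra_simps)
  have gen: "d (gen j) = a j" for j using step[of j 1] R by simp
  have "d (r * s) = d r * s + r * d s" for r s
  proof -
    have "(\<lambda>r. d (r * s)) = (\<lambda>r. d r * s + r * d s)"
    proof (rule lin_ops_eqI)
      show "(\<lambda>r. d (r * s)) \<in> lin_ops" "(\<lambda>r. d r * s + r * d s) \<in> lin_ops"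
        using d by (auto simp: lin_ops_iff algebra_simps smul_mult_left
            falg.scale_right_distrib)
      show "d (Poly_Mapping.single (Mon w) 1 * s) =
          d (Poly_Mapping.single (Mon w) 1) * s + Poly_Mapping.single (Mon w) 1 * d s" for w
        using R by (induction w) (simp_all add: single_Nil single_Cons step mult.assoc algebra_simps)
    qed
    then show ?thesis by (rule fun_cong)
  qed
  then show "derivation d \<and> (\<forall>j. d (gen j) = a j)" using d gen by (simp add: derivation_def)
qed

lemma ex1_partial: "\<exists>!d. derivation d \<and> (\<forall>j. d (gen j) = (if i = j then a else 0))"
proof -
  have "\<exists>!d. d \<in> lin_ops \<and> (\<forall>j. comm d (gen j) = (\<lambda>s. (if i = j then a else 0) * s)) \<and> d 1 = 0"
    by (rule ex1_comm) (auto simp: lin_ops_iff algebra_simps mult_smul_right)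
  moreover have "derivation d \<and> (\<forall>j. d (gen j) = (if i = j then a else 0)) \<longleftrightarrow>
      d \<in> lin_ops \<and> (\<forall>j. comm d (gen j) = (\<lambda>s. (if i = j then a else 0) * s)) \<and> d 1 = 0" for d
  proof (cases "d \<in> lin_ops")
    case True
    from derivation_iff_comm[OF this, of "\<lambda>j. if i = j then a else 0"] True
    show ?thesis by blast
  qed (simp add: derivation_def)
  ultimately show ?thesis by presburger
qed

lemma partial:
  "derivation (partial i a)" "partial i a (gen j) = (if i = j then a else 0)"
  using theI'[OF ex1_partial[of i a]] unfolding partial_def by blast+

lemma ex1_partial2:
  fixes i j :: 'n
  shows "\<exists>!\<phi> :: ('n, 'k::field) falg \<Rightarrow> ('n, 'k) falg. \<phi> \<in> lin_ops \<and> comm \<phi> (gen i) = partial j 1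
    \<and> (\<forall>l. l \<noteq> i \<longrightarrow> comm \<phi> (gen l) = (\<lambda>s. 0)) \<and> \<phi> 1 = 0"
proof -
  have j: "partial j (1 :: ('n, 'k) falg) \<in> lin_ops"
    using partial(1)[of j "1 :: ('n, 'k) falg"] by (simp add: derivation_def)
  let ?f = "\<lambda>l. if l = i then partial j (1 :: ('n, 'k) falg) else (\<lambda>s. 0)"
  have "\<exists>!\<phi>. \<phi> \<in> lin_ops \<and> (\<forall>l. comm \<phi> (gen l) = ?f l) \<and> \<phi> 1 = 0"
    by (rule ex1_comm) (use j in \<open>simp add: lin_ops_iff\<close>)
  moreover have "(\<forall>l. comm \<phi> (gen l) = ?f l) \<longleftrightarrow>
      comm \<phi> (gen i) = partial j 1 \<and> (\<forall>l. l \<noteq> i \<longrightarrow> comm \<phi> (gen l) = (\<lambda>s. 0))" for \<phi>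
    by auto
  ultimately show ?thesis by (simp only: conj_assoc)
qed

end

theory Submission
  imports Defs
begin

text \<open>The reason is abelianization. Let \<open>I\<close> be the two-sided ideal of \<open>R\<close> generated by all
  commutators. Every derivation maps \<open>I\<close> into \<open>I\<close>, and so do left and right multiplications; an
  operator of order at most 1 is built from these, and operators that preserve \<open>I\<close> form an
  algebra, so all of \<open>Delta\<close> preserves \<open>I\<close> (\<open>Delta_preserves\<close>). The operator
  $\partial_{(1,2)}^{(1,1)}$ deletes an \<open>x\<^sub>1\<close> and some later \<open>x\<^sub>2\<close>, so it distinguishes the
  order of letters: it maps \<open>x\<^sub>1 x\<^sub>2 - x\<^sub>2 x\<^sub>1\<close> to 1 (\<open>partial2_commutator\<close>), and \<open>1 \<notin> I\<close> because
  the augmentation \<open>R \<rightarrow> k\<close> kills commutators.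

  The structure of operators of order at most 1 is not needed in explicit form. An operator of
  order 0 becomes, modulo \<open>I\<close>, multiplication by an element of the commutative ring \<open>R/I\<close>
  (\<open>diff_lt_1_congruence\<close>). If all commutators \<open>[\<phi>, r]\<close> are of this kind, then \<open>\<phi>\<close> satisfies
  the Leibniz rule modulo \<open>I\<close> up to such multiplications, and the terms of \<open>\<phi> (u v s - v u s)\<close>
  cancel modulo \<open>I\<close>. The argument does not depend on the characteristic.\<close>

section \<open>The commutator ideal\<close>

inductive_set commutator_ideal :: "('n, 'k::field) falg set"
  where
    commutator: "r * (u * v - v * u) * s \<in> commutator_ideal"
  | add: "p \<in> commutator_ideal \<Longrightarrow> q \<in> commutator_ideal \<Longrightarrow> p + q \<in> commutator_ideal"

lemma commutator_ideal_zero: "0 \<in> commutator_ideal"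
  using commutator[of 0 0 0 0] by simp

lemma commutator_ideal_mult_left: "p \<in> commutator_ideal \<Longrightarrow> r * p \<in> commutator_ideal"
proof (induction rule: commutator_ideal.induct)
  case (commutator a u v b)
  then show ?case
    using commutator_ideal.commutator[of "r * a" u v b] by (simp add: mult.assoc)
qed (simp add: distrib_left commutator_ideal.add)

lemma commutator_ideal_diff:
  assumes "p \<in> commutator_ideal" "q \<in> commutator_ideal"
  shows "p - q \<in> commutator_ideal"
  using commutator_ideal.add[OF assms(1) commutator_ideal_mult_left[OF assms(2), of "-1"]] by simp

lemma commutator_mult_in_ideal: "u * v * s - v * u * s \<in> commutator_ideal"
  using commutator_ideal.commutator[of 1 u v s] by (simp add: left_diff_distrib)

text \<open>The constant coefficient is multiplicative because the free monoid has no invertible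
  elements except its unit.\<close>

lemma lookup_mult_zero:
  fixes p q :: "('n, 'k::field) falg"
  shows "Poly_Mapping.lookup (p * q) 0 = Poly_Mapping.lookup p 0 * Poly_Mapping.lookup q 0"
proof -
  have zero: "0 = a + b \<longleftrightarrow> a = 0 \<and> b = 0" for a b :: "'n fmon"
    by (cases a; cases b) (auto simp: zero_fmon_def)
  have "(\<Sum>b. Poly_Mapping.lookup q b when 0 = a + b) = (Poly_Mapping.lookup q 0 when a = 0)" for a
    by (cases "a = 0") (simp_all add: zero)
  then show ?thesis
    by (simp add: lookup_mult mult_when)
qed

lemma lookup_commutator_ideal: "p \<in> commutator_ideal \<Longrightarrow> Poly_Mapping.lookup p 0 = 0"
  by (induction rule: commutator_ideal.induct)
    (simp_all add: lookup_mult_zero lookup_minus lookup_add)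

lemma one_notin_commutator_ideal: "(1 :: ('n, 'k::field) falg) \<notin> commutator_ideal"
  using lookup_commutator_ideal[of "1 :: ('n, 'k) falg"] by (auto simp: lookup_one)


section \<open>Operators generated in order one preserve the commutator ideal\<close>

definition ideal_preserving :: "(('n, 'k::field) falg \<Rightarrow> ('n, 'k) falg) set"
  where "ideal_preserving = {\<phi> \<in> lin_ops. \<forall>p\<in>commutator_ideal. \<phi> p \<in> commutator_ideal}"

lemma subbimodule_ideal_preserving: "subbimodule ideal_preserving"
proof (rule subbimoduleI)
  show "ideal_preserving \<subseteq> lin_ops" by (auto simp: ideal_preserving_def)
  show "(\<lambda>s. 0) \<in> ideal_preserving"
    by (simp add: ideal_preserving_def lin_ops_iff commutator_ideal_zero)
next
  fix \<phi> \<psi> :: "('n, 'k::field) falg \<Rightarrow> ('n, 'k) falg"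
  assume "\<phi> \<in> ideal_preserving" "\<psi> \<in> ideal_preserving"
  then show "(\<lambda>s. \<phi> s + \<psi> s) \<in> ideal_preserving"
    by (simp add: ideal_preserving_def commutator_ideal.add
        subbimoduleD(3)[OF subbimodule_lin_ops])
next
  fix r and \<phi> :: "('n, 'k::field) falg \<Rightarrow> ('n, 'k) falg"
  assume \<phi>: "\<phi> \<in> ideal_preserving"
  then have "lact r \<phi> \<in> lin_ops" "ract \<phi> r \<in> lin_ops"
    by (simp_all add: ideal_preserving_def subbimoduleD(4,5)[OF subbimodule_lin_ops])
  with \<phi> show "lact r \<phi> \<in> ideal_preserving" "ract \<phi> r \<in> ideal_preserving"
    by (simp_all add: ideal_preserving_def lact_def ract_def commutator_ideal_mult_left)
qed

lemma subalgebra_ideal_preserving: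
  "subalgebra (ideal_preserving :: (('n, 'k::field) falg \<Rightarrow> ('n, 'k) falg) set)"
proof -
  let ?E = "ideal_preserving :: (('n, 'k) falg \<Rightarrow> ('n, 'k) falg) set"
  have "(\<lambda>s. smul c (\<phi> s)) \<in> ?E" if "\<phi> \<in> ?E" for c \<phi>
    using subbimoduleD(4)[OF subbimodule_ideal_preserving that, of "smul c 1"]
    by (simp add: lact_def smul_mult_left)
  moreover have "id \<in> ?E" "\<phi> \<in> ?E \<Longrightarrow> \<psi> \<in> ?E \<Longrightarrow> \<phi> \<circ> \<psi> \<in> ?E" for \<phi> \<psi>
    by (simp_all add: ideal_preserving_def lin_ops_iff)
  ultimately show ?thesis
    unfolding subalgebra_def
    by (simp add: subbimoduleD(1-3)[OF subbimodule_ideal_preserving])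
qed

text \<open>An operator of order 0 is a sum of maps \<open>s \<mapsto> a s b\<close>. Modulo the commutator ideal such a map
  commutes with left multiplications. This congruence is stable under both actions, so it passes
  from the generators to the whole bimodule.\<close>

lemma diff_lt_1_congruence:
  fixes \<psi> :: "('n, 'k::field) falg \<Rightarrow> ('n, 'k) falg"
  assumes "\<psi> \<in> diff_lt 1"
  shows "\<psi> (u * s) - u * \<psi> s \<in> commutator_ideal"
proof -
  let ?I = "commutator_ideal :: ('n, 'k) falg set"
  let ?M = "{\<psi> \<in> lin_ops. \<forall>u s. \<psi> (u * s) - u * \<psi> s \<in> ?I}"
  have "subbimodule ?M"
  proof (rule subbimoduleI)
    show "?M \<subseteq> lin_ops" by blast
    show "(\<lambda>s. 0) \<in> ?M"
      using subbimoduleD(2)[OF subbimodule_lin_ops] by (simp add: commutator_ideal_zero)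
  next
    fix \<phi> \<psi> assume a: "\<phi> \<in> ?M" "\<psi> \<in> ?M"
    have "\<phi> (u * s) + \<psi> (u * s) - u * (\<phi> s + \<psi> s) \<in> ?I" for u s
    proof -
      have "(\<phi> (u * s) - u * \<phi> s) + (\<psi> (u * s) - u * \<psi> s) \<in> ?I"
        using a by (intro commutator_ideal.add) auto
      then show ?thesis by (simp add: algebra_simps)
    qed
    then show "(\<lambda>s. \<phi> s + \<psi> s) \<in> ?M"
      using a subbimoduleD(3)[OF subbimodule_lin_ops] by blast
  next
    fix r \<psi> assume a: "\<psi> \<in> ?M"
    then have c: "\<psi> (u * s) - u * \<psi> s \<in> ?I" for u s by blast
    have "lact r \<psi> (u * s) - u * lact r \<psi> s \<in> ?I" for u s
    proof -
      have "r * (\<psi> (u * s) - u * \<psi> s) + (r * u * \<psi> s - u * r * \<psi> s) \<in> ?I"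
        by (rule commutator_ideal.add[OF commutator_ideal_mult_left[OF c]
              commutator_mult_in_ideal])
      then show ?thesis by (simp add: lact_def algebra_simps)
    qed
    then show "lact r \<psi> \<in> ?M"
      using a subbimoduleD(4)[OF subbimodule_lin_ops] by blast
    have "ract \<psi> r (u * s) - u * ract \<psi> r s \<in> ?I" for u s
    proof -
      have "(\<psi> ((r * u) * s) - (r * u) * \<psi> s) + (r * u * \<psi> s - u * r * \<psi> s)
          - u * (\<psi> (r * s) - r * \<psi> s) \<in> ?I"
        by (rule commutator_ideal_diff[OF commutator_ideal.add[OF c commutator_mult_in_ideal]
              commutator_ideal_mult_left[OF c]])
      then show ?thesis by (simp add: ract_def algebra_simps)
    qed
    then show "ract \<psi> r \<in> ?M"
      using a subbimoduleD(5)[OF subbimodule_lin_ops] by blast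
  qed
  moreover have "{\<phi> \<in> lin_ops. \<forall>r. comm \<phi> r \<in> diff_lt 0} \<subseteq> ?M"
    by (auto simp: comm_def lact_def ract_def fun_eq_iff commutator_ideal_zero)
  ultimately have "subbimodule hull {\<phi> \<in> lin_ops. \<forall>r. comm \<phi> r \<in> diff_lt 0} \<subseteq> ?M"
    by (rule hull_minimal[where S = subbimodule, rotated])
  then show ?thesis using assms unfolding One_nat_def diff_lt.simps(2)[of 0] by blast
qed

lemma diff_lt_1_ideal_preserving:
  fixes \<psi> :: "('n, 'k::field) falg \<Rightarrow> ('n, 'k) falg"
  assumes "\<psi> \<in> diff_lt 1"
  shows "\<psi> \<in> ideal_preserving"
proof -
  have lin: "\<psi> \<in> lin_ops" using assms by (rule diff_lt_subset_lin_ops)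
  have "\<psi> p \<in> commutator_ideal" if "p \<in> commutator_ideal" for p
    using that
  proof (induction rule: commutator_ideal.induct)
    case (commutator r u v s)
    let ?c = "r * (u * v - v * u)"
    have "(\<psi> (?c * s) - ?c * \<psi> s) + ?c * \<psi> s \<in> commutator_ideal"
      by (intro commutator_ideal.add commutator_ideal.commutator diff_lt_1_congruence assms)
    then show ?case by simp
  qed (use lin in \<open>auto simp: lin_ops_iff intro: commutator_ideal.add\<close>)
  then show ?thesis using lin by (simp add: ideal_preserving_def)
qed

lemma diff_le_1_ideal_preserving:
  "(diff_le 1 :: (('n, 'k::field) falg \<Rightarrow> ('n, 'k) falg) set) \<subseteq> ideal_preserving"
proof -
  let ?I = "commutator_ideal :: ('n, 'k) falg set"
  have "\<phi> \<in> ideal_preserving" if lin: "\<phi> \<in> lin_ops" and c: "\<And>r. comm \<phi> r \<in> diff_lt 1"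
    for \<phi> :: "('n, 'k) falg \<Rightarrow> ('n, 'k) falg"
  proof -
    have exp: "\<phi> (r * s) = r * \<phi> s + comm \<phi> r s" for r s
      by (simp add: comm_def lact_def ract_def)
    have comm_pres: "comm \<phi> r p \<in> ?I" if "p \<in> ?I" for r p
      using diff_lt_1_ideal_preserving[OF c[of r]] that by (simp add: ideal_preserving_def)
    have comm2: "\<phi> (u * v * s - v * u * s) \<in> ?I" for u v s
    proof -
      have "\<phi> (u * v * s - v * u * s)
          = (u * v * \<phi> s - v * u * \<phi> s)
            + (comm \<phi> u (v * s) - v * comm \<phi> u s)
            - (comm \<phi> v (u * s) - u * comm \<phi> v s)"
        by (simp add: lin_ops_diff[OF lin] mult.assoc exp algebra_simps)
      also have "\<dots> \<in> ?I"
        by (rule commutator_ideal_diff[OF commutator_ideal.add[OF commutator_mult_in_ideal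
                diff_lt_1_congruence[OF c]] diff_lt_1_congruence[OF c]])
      finally show ?thesis .
    qed
    have "\<phi> p \<in> ?I" if "p \<in> ?I" for p
      using that
    proof (induction rule: commutator_ideal.induct)
      case (commutator r u v s)
      have "r * \<phi> (u * v * s - v * u * s) + comm \<phi> r (u * v * s - v * u * s) \<in> ?I"
        by (intro commutator_ideal.add commutator_ideal_mult_left comm2 comm_pres
            commutator_mult_in_ideal)
      then show ?case
        by (simp add: exp[symmetric]) (simp add: algebra_simps)
    qed (use lin in \<open>auto simp: lin_ops_iff intro: commutator_ideal.add\<close>)
    then show ?thesis using lin by (simp add: ideal_preserving_def)
  qed
  then have "{\<phi> \<in> lin_ops. \<forall>r. comm \<phi> r \<in> diff_lt 1}
      \<subseteq> (ideal_preserving :: (('n, 'k) falg \<Rightarrow> ('n, 'k) falg) set)" by blast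
  then show ?thesis
    unfolding diff_le_def diff_lt.simps(2)[of 1]
    using subbimodule_ideal_preserving by (rule hull_minimal)
qed

lemma Delta_preserves: "Delta \<subseteq> ideal_preserving"
  unfolding Delta_def
  using diff_le_1_ideal_preserving subalgebra_ideal_preserving by (rule hull_minimal)


section \<open>The second order operator\<close>

lemma partial2:
  fixes i j :: 'n
  defines "\<phi> \<equiv> partial2 i j :: ('n, 'k::field) falg \<Rightarrow> ('n, 'k) falg"
  shows "\<phi> \<in> lin_ops" "comm \<phi> (gen i) = partial j 1"
    "l \<noteq> i \<Longrightarrow> comm \<phi> (gen l) = (\<lambda>s. 0)" "\<phi> 1 = 0"
  using theI'[OF ex1_partial2[of i j, where 'k = 'k]]
  unfolding \<phi>_def partial2_def by blast+

lemma partial2_commutator: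
  assumes "i \<noteq> j"
  shows "partial2 i j (gen i * gen j - gen j * gen i) = (1 :: ('n, 'k::field) falg)"
proof -
  let ?P = "partial2 i j :: ('n, 'k) falg \<Rightarrow> ('n, 'k) falg"
  have i: "?P (gen i * s) = gen i * ?P s + partial j 1 s" for s
    using fun_cong[OF partial2(2)[of i j], of s]
    by (simp add: comm_def lact_def ract_def algebra_simps)
  have j: "?P (gen j * s) = gen j * ?P s" for s
    using fun_cong[OF partial2(3)[of j i j], of s] assms
    by (simp add: comm_def lact_def ract_def)
  have "?P (gen i) = 0" "?P (gen j) = 0"
    using i[of 1] j[of 1] by (simp_all add: partial2(4) derivation_one[OF partial(1)])
  then show ?thesis
    by (simp add: lin_ops_diff[OF partial2(1)] i j partial(2))
qed

text \<open>The order of an operator can be tested on the generators, since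
  \<open>[\<phi>, r r'] = [\<phi>, r] r' + r [\<phi>, r']\<close>.\<close>

lemma diff_lt_gens:
  fixes \<phi> :: "('n, 'k::field) falg \<Rightarrow> ('n, 'k) falg"
  assumes lin: "\<phi> \<in> lin_ops" and gen: "\<And>i. comm \<phi> (gen i) \<in> diff_lt m"
  shows "\<phi> \<in> diff_lt (Suc m)"
proof (rule diff_lt_gen[OF lin])
  fix r :: "('n, 'k) falg"
  note B = subbimoduleD[OF subbimodule_diff_lt[of m]]
  have word: "comm \<phi> (Poly_Mapping.single (Mon w) 1) \<in> diff_lt m" for w
  proof (induction w)
    case Nil
    then show ?case using B(2) by (simp add: single_Nil comm_def lact_def ract_def)
  next
    case (Cons i w)
    let ?w = "Poly_Mapping.single (Mon w) 1"
    have "comm \<phi> (gen i * ?w) = (\<lambda>s. ract (comm \<phi> (gen i)) ?w s + lact (gen i) (comm \<phi> ?w) s)"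
      by (simp add: comm_def lact_def ract_def algebra_simps)
    then show ?case
      using B(3)[OF B(5)[OF gen[of i], of ?w] B(4)[OF Cons, of "gen i"]]
      by (simp add: single_Cons)
  qed
  have smul: "comm \<phi> (smul c p) \<in> diff_lt m" if "comm \<phi> p \<in> diff_lt m" for c p
  proof -
    have "comm \<phi> (smul c p) = lact (smul c 1) (comm \<phi> p)"
      using lin by (simp add: comm_def lact_def ract_def smul_mult_left lin_ops_iff
          falg.scale_right_diff_distrib)
    then show ?thesis using B(4)[OF that, of "smul c 1"] by simp
  qed
  have sum: "comm \<phi> (sum f A) \<in> diff_lt m"
    if "finite A" "\<And>a. comm \<phi> (f a) \<in> diff_lt m" for f and A :: "'n fmon set"
    using that(1)
  proof induction
    case empty
    then show ?case using B(2) by (simp add: comm_def lact_def ract_def lin_ops_zero[OF lin])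
  next
    case (insert a A)
    have "comm \<phi> (f a + sum f A) = (\<lambda>s. comm \<phi> (f a) s + comm \<phi> (sum f A) s)"
      using lin by (simp add: comm_def lact_def ract_def distrib_right lin_ops_iff add_diff_add)
    then show ?case using B(3)[OF that(2)[of a] insert.IH] insert.hyps by simp
  qed
  have "comm \<phi> (Poly_Mapping.single w 1) \<in> diff_lt m" for w
    using word by (cases w) simp
  then show "comm \<phi> r \<in> diff_lt m"
    by (subst falg_expand[of r]) (intro sum smul finite_keys)
qed

lemma derivation_diff_lt:
  assumes "derivation d"
  shows "d \<in> diff_lt 2"
proof -
  have "id \<in> diff_lt (Suc 0)"
    by (rule diff_lt_gen) (auto simp: lin_ops_iff comm_def lact_def ract_def)
  then have "lact (d r) id \<in> diff_lt (Suc 0)" for r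
    by (rule subbimoduleD(4)[OF subbimodule_diff_lt])
  moreover have "comm d r = lact (d r) id" for r
    using assms by (auto simp: derivation_def comm_def lact_def ract_def)
  ultimately have "comm d r \<in> diff_lt (Suc 0)" for r by (simp only:)
  moreover have "d \<in> lin_ops" using assms by (simp add: derivation_def)
  ultimately have "d \<in> diff_lt (Suc (Suc 0))" by (rule diff_lt_gen[rotated])
  then show ?thesis by (simp only: numeral_2_eq_2)
qed

lemma partial2_diff_ops: "(partial2 i j :: ('n, 'k::field) falg \<Rightarrow> ('n, 'k) falg) \<in> diff_ops"
proof -
  have "comm (partial2 i j :: ('n, 'k) falg \<Rightarrow> ('n, 'k) falg) (gen l) \<in> diff_lt 2" for l
  proof (cases "l = i")
    case True
    show ?thesis
      unfolding True partial2(2) by (rule derivation_diff_lt[OF partial(1)])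
  next
    case False
    show ?thesis
      unfolding partial2(3)[OF False] by (rule subbimoduleD(2)[OF subbimodule_diff_lt])
  qed
  then have "(partial2 i j :: ('n, 'k) falg \<Rightarrow> ('n, 'k) falg) \<in> diff_lt (Suc 2)"
    by (rule diff_lt_gens[OF partial2(1)])
  then show ?thesis unfolding diff_ops_iff by blast
qed

theorem mainTheorem3:
  fixes n :: nat and x :: "nat \<Rightarrow> 'n"
  assumes "n > 1" and "bij_betw x {1..n} UNIV"
  shows "(partial2 (x 1) (x 2) :: ('n, 'k::field) falg \<Rightarrow> ('n, 'k) falg) \<notin> Delta
    \<and> (Delta :: (('n, 'k) falg \<Rightarrow> ('n, 'k) falg) set) \<noteq> diff_ops"
proof -
  let ?P = "partial2 (x 1) (x 2) :: ('n, 'k) falg \<Rightarrow> ('n, 'k) falg"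
  let ?c = "gen (x 1) * gen (x 2) - gen (x 2) * gen (x 1) :: ('n, 'k) falg"
  have "x 1 \<noteq> x 2"
    using assms(1) inj_on_eq_iff[OF bij_betw_imp_inj_on[OF assms(2)], of 1 2] by simp
  then have "?P ?c = 1" by (rule partial2_commutator)
  moreover have "?c \<in> commutator_ideal"
    using commutator_mult_in_ideal[of "gen (x 1)" "gen (x 2)" 1] by simp
  ultimately have "?P \<notin> ideal_preserving"
    unfolding ideal_preserving_def using one_notin_commutator_ideal
    by (metis (no_types, lifting) mem_Collect_eq)
  then have "?P \<notin> Delta" using Delta_preserves by (rule contra_subsetD[rotated])
  then show ?thesis using partial2_diff_ops by metis
qed

end
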